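(* Let $U\subset\mathbb{H}$ be a symmetric slice domain. A function $F\colon U\to\mathbb{H}$ is slice regular on $U$ if and only if it is skew regular on $U$, in which case its skew derivative equals its slice derivative.
   Context: $\mathbb{H}$ is the skew field of quaternions with its Euclidean topology, $\mathbb{H}^*=\mathbb{H}\setminus\{0\}$. $\mathbb{H}^*$ acts on $\mathbb{H}$ by ${}^{p}q=pqp^{-1}$; $O(q)$ is the orbit of $q$. A region is a subset of $\mathbb{H}$ that is open and invariant under this action. $T$ denotes the identity function, and a constant function is denoted by its value. Skew product: for $F,G\colon X\to\mathbb{H}$ on an invariant set $X$, $(F\diamond G)(x)=F({}^{G(x)}x)\,G(x)$ if $G(x)\neq0$, and $(F\diamond G)(x)=0$ if $G(x)=0$. A function is skew invertible if it has a two-sided inverse with respect to $\diamond$ (unit: the constant function $1$); the skew inverse of $F$ is written $F^{\langle-1\rangle}$. For $q_0\in\mathbb{H}$, $T-q_0$ is skew invertible on $\mathbb{H}\setminus O(q_0)$. Skew regularity: $F\colon U\to\mathbb{H}$ on a region $U$ is skew differentiable at $q\in U$ if there is a function $\mathcal{D}_q(F)\colon U\to\mathbb{H}$ continuous at all $p\in O(q)$ with $F=F(q)+\mathcal{D}_q(F)\diamond(T-q)$ on $U$ (such a function is unique). $F$ is skew regular on $U$ if it is skew differentiable at all points of $U$. The skew derivative at $q_0$ is $F'(q_0)=\lim_{q\to q_0,\ q\notin O(q_0)}\left((F-F(q_0))\diamond(T-q_0)^{\langle-1\rangle}\right)(q)$ (equivalently $\mathcal{D}_{q_0}(F)(q_0)$).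 Slice regularity: let $\mathbb{S}=\{I\in\mathbb{H}: I^2=-1\}$, and for $I\in\mathbb{S}$, $U_I=U\cap(\mathbb{R}+\mathbb{R}I)$ with coordinates $x+yI$. $F\colon U\to\mathbb{H}$ on an open set $U$ is slice regular if for each $I\in\mathbb{S}$ the restriction $F_I$ of $F$ to $U_I$ has continuous partial derivatives and $\frac12\left(\frac{\partial F_I}{\partial x}+\frac{\partial F_I}{\partial y}I\right)=0$ on $U_I$. Its slice derivative at $q\in U_I$ is $F_s'(q)=\frac12\left(\frac{\partial F_I}{\partial x}-\frac{\partial F_I}{\partial y}I\right)(q)$. A slice domain is a connected open subset $U\subset\mathbb{H}$ such that $U\cap\mathbb{R}\neq\emptyset$ and $U\cap(\mathbb{R}+\mathbb{R}q)$ is connected for all $q\in U\setminus\mathbb{R}$. It is symmetric if it is invariant under the action ${}^{p}q=pqp^{-1}$. *)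

theory Defs
  imports "HOL-Analysis.Analysis"
begin

datatype quat = Quat (qr: real) (qi: real) (qj: real) (qk: real)

lemma quat_eq_iff: "p = q \<longleftrightarrow> qr p = qr q \<and> qi p = qi q \<and> qj p = qj q \<and> qk p = qk q"
  by (cases p; cases q) simp

instantiation quat :: ring_1
begin

definition "0 = Quat 0 0 0 0"
definition "1 = Quat 1 0 0 0"
definition "p + q = Quat (qr p + qr q) (qi p + qi q) (qj p + qj q) (qk p + qk q)"
definition "p - q = Quat (qr p - qr q) (qi p - qi q) (qj p - qj q) (qk p - qk q)"
definition "- q = Quat (- qr q) (- qi q) (- qj q) (- qk q)"
definition "p * q = Quat
  (qr p * qr q - qi p * qi q - qj p * qj q - qk p * qk q)
  (qr p * qi q + qi p * qr q + qj p * qk q - qk p * qj q)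
  (qr p * qj q - qi p * qk q + qj p * qr q + qk p * qi q)
  (qr p * qk q + qi p * qj q - qj p * qi q + qk p * qr q)"

instance
  by standard (simp_all add: zero_quat_def one_quat_def plus_quat_def minus_quat_def
      uminus_quat_def times_quat_def algebra_simps)

end

lemma quat_zero_sel [simp]: "qr 0 = 0" "qi 0 = 0" "qj 0 = 0" "qk 0 = 0"
  by (simp_all add: zero_quat_def)

lemma quat_one_sel [simp]: "qr 1 = 1" "qi 1 = 0" "qj 1 = 0" "qk 1 = 0"
  by (simp_all add: one_quat_def)

lemma quat_add_sel [simp]:
  "qr (p + q) = qr p + qr q" "qi (p + q) = qi p + qi q"
  "qj (p + q) = qj p + qj q" "qk (p + q) = qk p + qk q"
  by (simp_all add: plus_quat_def)

lemma quat_diff_sel [simp]: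
  "qr (p - q) = qr p - qr q" "qi (p - q) = qi p - qi q"
  "qj (p - q) = qj p - qj q" "qk (p - q) = qk p - qk q"
  by (simp_all add: minus_quat_def)

lemma quat_minus_sel [simp]:
  "qr (- q) = - qr q" "qi (- q) = - qi q" "qj (- q) = - qj q" "qk (- q) = - qk q"
  by (simp_all add: uminus_quat_def)

lemma quat_mult_sel:
  "qr (p * q) = qr p * qr q - qi p * qi q - qj p * qj q - qk p * qk q"
  "qi (p * q) = qr p * qi q + qi p * qr q + qj p * qk q - qk p * qj q"
  "qj (p * q) = qr p * qj q - qi p * qk q + qj p * qr q + qk p * qi q"
  "qk (p * q) = qr p * qk q + qi p * qj q - qj p * qi q + qk p * qr q"
  by (simp_all add: times_quat_def)

instantiation quat :: real_algebra_1
begin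

definition "a *\<^sub>R q = Quat (a * qr q) (a * qi q) (a * qj q) (a * qk q)"

instance
  by standard (simp_all add: quat_eq_iff quat_mult_sel scaleR_quat_def algebra_simps)

end

lemma quat_scaleR_sel [simp]:
  "qr (a *\<^sub>R q) = a * qr q" "qi (a *\<^sub>R q) = a * qi q"
  "qj (a *\<^sub>R q) = a * qj q" "qk (a *\<^sub>R q) = a * qk q"
  by (simp_all add: scaleR_quat_def)

instantiation quat :: real_div_algebra
begin

definition "inverse q =
  inverse ((qr q)\<^sup>2 + (qi q)\<^sup>2 + (qj q)\<^sup>2 + (qk q)\<^sup>2) *\<^sub>R Quat (qr q) (- qi q) (- qj q) (- qk q)"
definition "p div q = p * inverse (q :: quat)"

instance
proof
  fix q :: quat
  define n where "n = (qr q)\<^sup>2 + (qi q)\<^sup>2 + (qj q)\<^sup>2 + (qk q)\<^sup>2"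
  assume "q \<noteq> 0"
  then have n: "inverse n * n = 1"
    by (simp add: n_def quat_eq_iff add_nonneg_eq_0_iff)
  let ?c = "Quat (qr q) (- qi q) (- qj q) (- qk q)"
  have "?c * q = n *\<^sub>R 1" "q * ?c = n *\<^sub>R 1"
    by (simp_all add: n_def quat_eq_iff quat_mult_sel power2_eq_square)
  then show "inverse q * q = 1" "q * inverse q = 1"
    by (simp_all add: inverse_quat_def n_def [symmetric] n)
qed (simp_all add: inverse_quat_def divide_quat_def quat_eq_iff)

end

instantiation quat :: real_inner
begin

definition "inner p q = qr p * qr q + qi p * qi q + qj p * qj q + qk p * qk q"
definition "norm q = sqrt (inner q (q :: quat))"
definition "dist p q = norm (p - q :: quat)"
definition "sgn q = q /\<^sub>R norm (q :: quat)"
definition [code del]: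
  "(uniformity :: (quat \<times> quat) filter) = (INF e\<in>{0 <..}. principal {(x, y). dist x y < e})"
definition [code del]:
  "open (U :: quat set) \<longleftrightarrow> (\<forall>x\<in>U. eventually (\<lambda>(x', y). x' = x \<longrightarrow> y \<in> U) uniformity)"

instance
proof
  fix p q r :: quat and a :: real
  show "inner p q = inner q p" "inner (p + q) r = inner p r + inner q r"
    "inner (a *\<^sub>R p) q = a * inner p q"
    by (simp_all add: inner_quat_def algebra_simps)
  show "0 \<le> inner p p"
    by (simp add: inner_quat_def)
  show "inner p p = 0 \<longleftrightarrow> p = 0"
    by (auto simp: inner_quat_def quat_eq_iff add_nonneg_eq_0_iff)
qed (simp_all add: norm_quat_def dist_quat_def sgn_quat_def uniformity_quat_def open_quat_def)

end

instance quat :: real_normed_div_algebra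
proof
  fix p q :: quat
  have "inner (p * q) (p * q) = inner p p * inner q q"
    unfolding inner_quat_def quat_mult_sel by algebra
  then show "norm (p * q) = norm p * norm q"
    by (simp add: norm_quat_def real_sqrt_mult)
qed

instantiation quat :: euclidean_space
begin

definition "Basis = {Quat 1 0 0 0, Quat 0 1 0 0, Quat 0 0 1 0, Quat 0 0 0 1}"

instance
proof
  fix q :: quat
  show "(\<forall>u\<in>Basis. inner q u = 0) \<longleftrightarrow> q = 0"
    by (simp add: Basis_quat_def inner_quat_def quat_eq_iff [of q 0])
qed (auto simp: Basis_quat_def inner_quat_def)

end

definition conj_act :: "quat \<Rightarrow> quat \<Rightarrow> quat" where
  "conj_act p q = p * q * inverse p"

definition orbit :: "quat \<Rightarrow> quat set" where
  "orbit q = {conj_act p q | p. p \<noteq> 0}"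

definition invariant :: "quat set \<Rightarrow> bool" where
  "invariant X \<longleftrightarrow> (\<forall>p q. p \<noteq> 0 \<longrightarrow> q \<in> X \<longrightarrow> conj_act p q \<in> X)"

text \<open>Functions on a set \<open>X\<close> are represented by total functions of which only the values on
  \<open>X\<close> matter; for invariant \<open>X\<close>, the values of a skew product on \<open>X\<close> depend only on the values
  of its factors on \<open>X\<close>.\<close>

definition skew_prod :: "(quat \<Rightarrow> quat) \<Rightarrow> (quat \<Rightarrow> quat) \<Rightarrow> quat \<Rightarrow> quat"  (infixl "\<diamondop>" 70) where
  "(F \<diamondop> G) x = (if G x = 0 then 0 else F (conj_act (G x) x) * G x)"

definition is_skew_inverse_on :: "quat set \<Rightarrow> (quat \<Rightarrow> quat) \<Rightarrow> (quat \<Rightarrow> quat) \<Rightarrow> bool" where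
  "is_skew_inverse_on X F G \<longleftrightarrow> (\<forall>x\<in>X. (F \<diamondop> G) x = 1 \<and> (G \<diamondop> F) x = 1)"

text \<open>If \<open>F\<close> is skew invertible on an invariant set \<open>X\<close>, this determines the values of the skew
  inverse on \<open>X\<close> uniquely, since \<open>\<diamondop>\<close> is associative.\<close>

definition skew_inverse_on :: "quat set \<Rightarrow> (quat \<Rightarrow> quat) \<Rightarrow> quat \<Rightarrow> quat" where
  "skew_inverse_on X F = (SOME G. is_skew_inverse_on X F G)"

definition skew_differentiable_at :: "quat set \<Rightarrow> (quat \<Rightarrow> quat) \<Rightarrow> quat \<Rightarrow> bool" where
  "skew_differentiable_at U F q \<longleftrightarrow>
    (\<exists>D. (\<forall>p\<in>orbit q. continuous (at p within U) D) \<and>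
         (\<forall>x\<in>U. F x = F q + (D \<diamondop> (\<lambda>t. t - q)) x))"

definition skew_regular_on :: "quat set \<Rightarrow> (quat \<Rightarrow> quat) \<Rightarrow> bool" where
  "skew_regular_on U F \<longleftrightarrow> (\<forall>q\<in>U. skew_differentiable_at U F q)"

definition has_skew_derivative :: "quat set \<Rightarrow> (quat \<Rightarrow> quat) \<Rightarrow> quat \<Rightarrow> quat \<Rightarrow> bool" where
  "has_skew_derivative U F q0 d \<longleftrightarrow>
    (((\<lambda>t. F t - F q0) \<diamondop> skew_inverse_on (- orbit q0) (\<lambda>t. t - q0)) \<longlongrightarrow> d)
      (at q0 within (U - orbit q0))"

definition imag_units :: "quat set" where
  "imag_units = {I. I\<^sup>2 = -1}"

definition slice_plane :: "quat \<Rightarrow> quat set" where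
  "slice_plane q = {of_real x + of_real y * q | x y. True}"

text \<open>The partial derivatives of \<open>(x, y) \<mapsto> F (x + y I)\<close> at the point \<open>q = x + y I\<close>, that is, the
  derivatives of \<open>F\<close> at \<open>q\<close> along the directions \<open>1\<close> and \<open>I\<close>.\<close>

definition slice_dx :: "(quat \<Rightarrow> quat) \<Rightarrow> quat \<Rightarrow> quat" where
  "slice_dx F q = vector_derivative (\<lambda>t. F (q + of_real t)) (at 0)"

definition slice_dy :: "quat \<Rightarrow> (quat \<Rightarrow> quat) \<Rightarrow> quat \<Rightarrow> quat" where
  "slice_dy I F q = vector_derivative (\<lambda>t. F (q + of_real t * I)) (at 0)"

definition slice_regular_on :: "quat set \<Rightarrow> (quat \<Rightarrow> quat) \<Rightarrow> bool" where
  "slice_regular_on U F \<longleftrightarrow> (\<forall>I\<in>imag_units.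
    (\<forall>q \<in> U \<inter> slice_plane I.
      (\<lambda>t. F (q + of_real t)) differentiable (at 0) \<and>
      (\<lambda>t. F (q + of_real t * I)) differentiable (at 0)) \<and>
    continuous_on (U \<inter> slice_plane I) (slice_dx F) \<and>
    continuous_on (U \<inter> slice_plane I) (slice_dy I F) \<and>
    (\<forall>q \<in> U \<inter> slice_plane I. (1/2) *\<^sub>R (slice_dx F q + slice_dy I F q * I) = 0))"

text \<open>For \<open>q \<in> U \<inter> slice_plane I\<close>. Replacing \<open>I\<close> by \<open>- I\<close> gives the same value; at a real
  point, every \<open>I\<close> is admissible, and independence of \<open>I\<close> holds for slice regular \<open>F\<close>.\<close>

definition slice_derivative :: "quat \<Rightarrow> (quat \<Rightarrow> quat) \<Rightarrow> quat \<Rightarrow> quat" where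
  "slice_derivative I F q = (1/2) *\<^sub>R (slice_dx F q - slice_dy I F q * I)"

definition slice_domain :: "quat set \<Rightarrow> bool" where
  "slice_domain U \<longleftrightarrow> open U \<and> connected U \<and> U \<inter> \<real> \<noteq> {} \<and>
    (\<forall>q \<in> U - \<real>. connected (U \<inter> slice_plane q))"

end

theory Submission
  imports Defs "HOL-Complex_Analysis.Complex_Analysis"
begin

text \<open>Restricted to a slice \<open>\<real> + \<real>I\<close>, the skew difference quotient at \<open>q\<close> is the ordinary quotient
  \<open>(F x - F q) (x - q)\<^sup>-\<^sup>1\<close>, so skew regularity makes every restriction holomorphic with respect to
  right multiplication by \<open>I\<close>, and Goursat's theorem gives slice regularity.
  Conversely, the identity theorem yields the representation formula
  \<open>F (x + y J) = A (x, y) + B (x, y) J\<close> for all imaginary units \<open>J\<close>. Given \<open>q\<close> in the slice of \<open>I\<close>,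
  the quotient \<open>(F x - F q) (x - q)\<^sup>-\<^sup>1\<close> on that slice extends by the same formula to a continuous
  function on \<open>U\<close>, and this extension is \<open>\<D>\<^sub>q F\<close>. The skew derivative is then its value at \<open>q\<close>.\<close>

section \<open>Imaginary units and slices as embedded complex planes\<close>

text \<open>For an imaginary unit \<open>I\<close> this is an isometric ring embedding, so functions
  on a slice can be studied as functions of a complex variable.\<close>

definition emb :: "quat \<Rightarrow> complex \<Rightarrow> quat" where
  "emb I z = Re z *\<^sub>R 1 + Im z *\<^sub>R I"

lemma imag_units_iff: "I \<in> imag_units \<longleftrightarrow> qr I = 0 \<and> (qi I)\<^sup>2 + (qj I)\<^sup>2 + (qk I)\<^sup>2 = 1"
proof
  assume "I \<in> imag_units"
  then have eq: "I * I = -1" by (simp add: imag_units_def power2_eq_square)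
  have r: "qr I * qr I - qi I * qi I - qj I * qj I - qk I * qk I = -1"
    and i: "qr I * qi I = 0" and j: "qr I * qj I = 0" and k: "qr I * qk I = 0"
    using eq by (auto simp: quat_eq_iff quat_mult_sel)
  have "qr I = 0"
  proof (rule ccontr)
    assume "qr I \<noteq> 0"
    with i j k have "qi I = 0" "qj I = 0" "qk I = 0" by auto
    with r have "qr I * qr I = -1" by simp
    then show False by (metis not_square_less_zero neg_less_0_iff_less zero_less_one)
  qed
  with r show "qr I = 0 \<and> (qi I)\<^sup>2 + (qj I)\<^sup>2 + (qk I)\<^sup>2 = 1"
    by (simp add: power2_eq_square)
next
  assume "qr I = 0 \<and> (qi I)\<^sup>2 + (qj I)\<^sup>2 + (qk I)\<^sup>2 = 1"
  then show "I \<in> imag_units"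
    by (auto simp: imag_units_def power2_eq_square quat_eq_iff quat_mult_sel algebra_simps)
qed

lemma imag_unit_square:
  assumes "I \<in> imag_units"
  shows "I * I = -1" and "I * (I * q) = - q"
proof -
  show "I * I = -1" using assms by (simp add: imag_units_def power2_eq_square)
  then show "I * (I * q) = - q" by (simp flip: mult.assoc)
qed

lemma imag_unit_minus: "I \<in> imag_units \<Longrightarrow> - I \<in> imag_units"
  by (simp add: imag_units_def)

lemma norm_imag_unit: "I \<in> imag_units \<Longrightarrow> norm I = 1"
  by (simp add: imag_units_iff norm_quat_def inner_quat_def flip: power2_eq_square)

lemma imag_units_ex: "\<exists>I. I \<in> imag_units"
  by (rule exI[of _ "Quat 0 1 0 0"]) (simp add: imag_units_iff)

lemma inner_one_imag_unit: "I \<in> imag_units \<Longrightarrow> inner 1 I = 0"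
  by (simp add: imag_units_iff inner_quat_def)

text \<open>The sum intertwines the units: \<open>(I + J) * I = -1 + J * I = J * (I + J)\<close>. It
  vanishes only for \<open>J = - I\<close>, where an element anticommuting with \<open>I\<close> is
  required.\<close>

lemma imag_units_conjugate:
  assumes "I \<in> imag_units" "J \<in> imag_units"
  shows "\<exists>p. p \<noteq> 0 \<and> p * I = J * p"
proof (cases "J = - I")
  case False
  have "(I + J) * I = J * (I + J)"
    using assms by (simp add: algebra_simps imag_unit_square)
  moreover have "I + J \<noteq> 0"
    using False by (metis add_eq_0_iff)
  ultimately show ?thesis by blast
next
  case True
  \<comment> \<open>An imaginary quaternion orthogonal to \<open>I\<close> anticommutes with it. The
    choice \<open>(- qj I, qi I, 0)\<close> degenerates when \<open>I\<close> is plus or minus k,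
    and there i serves.\<close>
  show ?thesis
  proof (cases "qi I = 0 \<and> qj I = 0")
    case t: True
    then show ?thesis using assms(1) True
      by (intro exI[of _ "Quat 0 1 0 0"]) (auto simp: quat_eq_iff quat_mult_sel imag_units_iff)
  next
    case False
    then show ?thesis using assms(1) True
      by (intro exI[of _ "Quat 0 (- qj I) (qi I) 0"])
        (auto simp: quat_eq_iff quat_mult_sel imag_units_iff)
  qed
qed

lemma emb_simps [simp]:
  "emb I 0 = 0" "emb I 1 = 1" "emb I (of_real t) = of_real t"
  "emb I (w + z) = emb I w + emb I z" "emb I (w - z) = emb I w - emb I z"
  by (auto simp: emb_def algebra_simps scaleR_conv_of_real)

lemma emb_cnj: "emb I (cnj z) = emb (- I) z"
  by (simp add: emb_def)

lemma emb_mult: "I \<in> imag_units \<Longrightarrow> emb I (w * z) = emb I w * emb I z"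
  by (simp add: emb_def algebra_simps imag_unit_square)

lemma bounded_linear_emb: "bounded_linear (emb I)"
  unfolding emb_def
  by (intro bounded_linear_add bounded_linear_compose[OF bounded_linear_scaleR_left]
      bounded_linear_Re bounded_linear_Im)

lemma continuous_on_emb [continuous_intros]: "continuous_on S (emb I)"
  by (simp add: bounded_linear_emb linear_continuous_on)

lemma norm_emb: "I \<in> imag_units \<Longrightarrow> norm (emb I z) = norm z"
proof -
  assume I: "I \<in> imag_units"
  have "inner I I = 1"
    using norm_imag_unit[OF I] by (simp add: norm_eq_1)
  moreover have "inner 1 (1::quat) = 1"
    by (simp add: dot_square_norm)
  ultimately have "inner (emb I z) (emb I z) = (Re z)\<^sup>2 + (Im z)\<^sup>2"
    by (simp add: emb_def inner_add_left inner_add_right inner_one_imag_unit[OF I]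
        inner_commute[of I 1] power2_eq_square)
  then show ?thesis
    by (simp add: norm_eq_sqrt_inner[of "emb I z"] cmod_def)
qed

lemma emb_eq_0_iff: "I \<in> imag_units \<Longrightarrow> emb I z = 0 \<longleftrightarrow> z = 0"
  by (metis norm_emb norm_eq_zero)

text \<open>1 and \<open>I\<close> are orthonormal. This left inverse is continuous on all
  quaternions, so it carries connectedness and continuity between a slice and the complex
  plane.\<close>

lemma emb_left_inverse:
  assumes "I \<in> imag_units"
  shows "Complex (inner (emb I z) 1) (inner (emb I z) I) = z"
  using norm_imag_unit[OF assms] inner_one_imag_unit[OF assms]
  by (simp add: emb_def inner_add_left inner_commute[of I 1] dot_square_norm)

lemma slice_plane_eq: "slice_plane I = range (emb I)"
proof -
  have "of_real x + of_real y * I = emb I (Complex x y)" for x y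
    by (simp add: emb_def scaleR_conv_of_real)
  then show ?thesis
    unfolding slice_plane_def by (auto simp: image_iff) (metis complex.collapse)
qed

text \<open>The unit is the normalised imaginary part; at a real point any unit serves.\<close>

lemma quat_emb_ex:
  obtains I z where "I \<in> imag_units" "q = emb I z"
proof (cases "q = of_real (qr q)")
  case True
  obtain I where "I \<in> imag_units" using imag_units_ex ..
  moreover have "q = emb I (of_real (qr q))" using True by simp
  ultimately show ?thesis by (rule that)
next
  case False
  define v where "v = q - of_real (qr q)"
  have "v \<noteq> 0" using False by (simp add: v_def)
  have v: "qr v = 0" by (simp add: v_def of_real_def)
  have n: "norm v ^ 2 = (qi v)\<^sup>2 + (qj v)\<^sup>2 + (qk v)\<^sup>2"
    using v by (simp add: power2_norm_eq_inner inner_quat_def) (simp add: power2_eq_square)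
  have "norm (sgn v) = 1" using \<open>v \<noteq> 0\<close> by (simp add: norm_sgn)
  then have "sgn v \<in> imag_units"
    using v \<open>v \<noteq> 0\<close> 
    by (simp add: imag_units_iff sgn_div_norm power_mult_distrib power_inverse n flip: distrib_left)
       (simp flip: n)
  moreover have "q = emb (sgn v) (Complex (qr q) (norm v))"
    using \<open>v \<noteq> 0\<close> by (simp add: emb_def sgn_div_norm) (simp add: v_def of_real_def)
  ultimately show ?thesis by (rule that)
qed

lemma conj_act_emb: "p \<noteq> 0 \<Longrightarrow> conj_act p (emb I z) = emb (conj_act p I) z"
  by (simp add: conj_act_def emb_def algebra_simps)

lemma conj_act_imag_unit:
  assumes "p \<noteq> 0" "I \<in> imag_units"
  shows "conj_act p I \<in> imag_units"
proof -
  have "conj_act p I * conj_act p I = p * I * (inverse p * p) * I * inverse p"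
    unfolding conj_act_def by (simp only: mult.assoc)
  also have "\<dots> = p * (I * I) * inverse p"
    using assms(1) by (simp add: mult.assoc)
  also have "\<dots> = -1"
    using assms(1) by (simp add: imag_unit_square[OF assms(2)])
  finally show ?thesis by (simp add: imag_units_def power2_eq_square)
qed

text \<open>The imaginary units form one conjugacy class and conjugation fixes the reals, so an
  orbit contains the whole sphere of points with the same coordinates. Invariant sets therefore look
  alike in every slice.\<close>

lemma orbit_emb:
  assumes "I \<in> imag_units" "J \<in> imag_units"
  shows "emb J z \<in> orbit (emb I z)"
proof -
  obtain p where p: "p \<noteq> 0" "p * I = J * p"
    using imag_units_conjugate[OF assms] by blast
  then have "conj_act p I = J" by (simp add: conj_act_def mult.assoc)
  with p show ?thesis unfolding orbit_def by (auto intro!: exI[of _ p] simp: conj_act_emb)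
qed

lemma orbit_self: "q \<in> orbit q"
  unfolding orbit_def by (auto intro!: exI[of _ 1] simp: conj_act_def)

lemma orbit_subset: "invariant U \<Longrightarrow> q \<in> U \<Longrightarrow> orbit q \<subseteq> U"
  by (auto simp: orbit_def invariant_def)

lemma invariant_emb:
  assumes "invariant U" "I \<in> imag_units" "J \<in> imag_units" "emb I z \<in> U"
  shows "emb J z \<in> U"
  using orbit_emb[OF assms(2,3)] orbit_subset[OF assms(1,4)] by blast

lemma open_emb_vimage: "open U \<Longrightarrow> open {z. emb I z \<in> U}"
  using open_vimage[OF _ continuous_on_emb[of UNIV I]] by (simp add: vimage_def)

lemma invariant_emb_cnj:
  assumes "invariant U" "I \<in> imag_units" "emb I z \<in> U"
  shows "emb I (cnj z) \<in> U"
  unfolding emb_cnj by (rule invariant_emb[OF assms(1,2) imag_unit_minus[OF assms(2)] assms(3)])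

section \<open>Complex differentiability on a slice\<close>

lemma slice_partial_x:
  assumes "(\<lambda>t. F (emb I (Complex x y) + of_real t)) differentiable (at 0)"
  shows "((\<lambda>s. F (emb I (Complex s y))) has_vector_derivative slice_dx F (emb I (Complex x y))) (at x)"
proof -
  let ?f = "\<lambda>t. F (emb I (Complex x y) + of_real t)" and ?g = "\<lambda>s. s - x"
  have "(?f has_vector_derivative slice_dx F (emb I (Complex x y))) (at (?g x))"
    using assms by (simp add: slice_dx_def vector_derivative_works)
  moreover have "(?g has_vector_derivative 1) (at x)"
    by (auto intro!: derivative_eq_intros)
  ultimately have "(?f \<circ> ?g has_vector_derivative 1 *\<^sub>R slice_dx F (emb I (Complex x y))) (at x)"
    by (intro vector_diff_chain_at)
  moreover have "?f \<circ> ?g = (\<lambda>s. F (emb I (Complex s y)))"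
    by (auto simp: emb_def fun_eq_iff of_real_def algebra_simps)
  ultimately show ?thesis by simp
qed

lemma slice_partial_y:
  assumes "(\<lambda>t. F (emb I (Complex x y) + of_real t * I)) differentiable (at 0)"
  shows "((\<lambda>s. F (emb I (Complex x s))) has_vector_derivative slice_dy I F (emb I (Complex x y))) (at y)"
proof -
  let ?f = "\<lambda>t. F (emb I (Complex x y) + of_real t * I)" and ?g = "\<lambda>s. s - y"
  have "(?f has_vector_derivative slice_dy I F (emb I (Complex x y))) (at (?g y))"
    using assms by (simp add: slice_dy_def vector_derivative_works)
  moreover have "(?g has_vector_derivative 1) (at y)"
    by (auto intro!: derivative_eq_intros)
  ultimately have "(?f \<circ> ?g has_vector_derivative 1 *\<^sub>R slice_dy I F (emb I (Complex x y))) (at y)"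
    by (intro vector_diff_chain_at)
  moreover have "?f \<circ> ?g = (\<lambda>s. F (emb I (Complex x s)))"
    by (auto simp: emb_def fun_eq_iff of_real_def algebra_simps)
  ultimately show ?thesis by simp
qed

text \<open>Continuous partial derivatives give a total derivative, and the Cauchy-Riemann equation
  turns it into a left factor times \<open>emb I h\<close>: this is complex differentiability with
  \<open>I\<close> acting from the right.\<close>

lemma slice_regular_has_derivative:
  assumes "slice_regular_on U F" "open U" "I \<in> imag_units" "emb I z \<in> U"
  shows "((\<lambda>w. F (emb I w)) has_derivative (\<lambda>h. slice_dx F (emb I z) * emb I h)) (at z)"
proof -
  define W where "W = U \<inter> slice_plane I"
  have W: "emb I w \<in> W \<longleftrightarrow> emb I w \<in> U" for w
    by (auto simp: W_def slice_plane_eq)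
  have dx: "((\<lambda>s. F (emb I (Complex s y))) has_vector_derivative slice_dx F (emb I (Complex x y))) (at x)"
    and dy: "((\<lambda>s. F (emb I (Complex x s))) has_vector_derivative slice_dy I F (emb I (Complex x y))) (at y)"
    if "emb I (Complex x y) \<in> U" for x y
    using assms(1,3) that by (auto simp: slice_regular_on_def slice_plane_eq
        intro!: slice_partial_x slice_partial_y)
  have cont: "continuous_on W (slice_dy I F)"
    and dbar: "q \<in> W \<Longrightarrow> slice_dx F q + slice_dy I F q * I = 0" for q
    using assms(1,3) by (auto simp: slice_regular_on_def W_def)
  have dy_eq: "slice_dy I F q = slice_dx F q * I" if "q \<in> W" for q
  proof -
    have "slice_dx F q * I + slice_dy I F q * (I * I) = (slice_dx F q + slice_dy I F q * I) * I"
      by (simp add: algebra_simps)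
    also have "\<dots> = 0" using dbar[OF that] by simp
    finally show ?thesis by (simp add: imag_unit_square[OF assms(3)])
  qed
  define O2 where "O2 = {p. emb I (Complex (fst p) (snd p)) \<in> U}"
  have c2: "continuous_on UNIV (\<lambda>p. emb I (Complex (fst p) (snd p)))"
    unfolding emb_def by (simp, intro continuous_intros)
  have "open O2"
    unfolding O2_def using open_vimage[OF assms(2) c2] by (simp add: vimage_def)
  moreover have "(Re z, Im z) \<in> O2" using assms(4) by (simp add: O2_def)
  ultimately obtain A B where AB: "open A" "open B" "Re z \<in> A" "Im z \<in> B" "A \<times> B \<subseteq> O2"
    by (auto elim!: open_prod_elim)
  \<comment> \<open>The vertical side is shrunk to an interval, since
    \<open>has_derivative_partialsI\<close> asks for convexity in the second variable.\<close>
  obtain e where e: "e > 0" "ball (Im z) e \<subseteq> B"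
    using AB(2,4) openE by blast
  define Y where "Y = ball (Im z) e"
  have XY: "A \<times> Y \<subseteq> O2" using AB(5) e by (auto simp: Y_def)
  have inU: "emb I (Complex x y) \<in> U" if "x \<in> A" "y \<in> Y" for x y
    using XY that by (auto simp: O2_def)
  let ?f = "\<lambda>x y. F (emb I (Complex x y))"
  \<comment> \<open>The second partial derivative has to be an operator depending continuously on
    the point, hence the wrapping as a bounded linear function.\<close>
  let ?fy = "\<lambda>x y. blinfun_scaleR_left (slice_dy I F (emb I (Complex x y)))"
  have "((\<lambda>(x, y). ?f x y) has_derivative
    (\<lambda>(tx, ty). tx *\<^sub>R slice_dx F (emb I z) + blinfun_apply (?fy (Re z) (Im z)) ty))
    (at (Re z, Im z) within A \<times> Y)"
  proof (rule has_derivative_partialsI)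
    show "((\<lambda>x. ?f x (Im z)) has_derivative (\<lambda>tx. tx *\<^sub>R slice_dx F (emb I z))) (at (Re z) within A)"
      using dx[of "Re z" "Im z"] assms(4)
      by (simp add: has_vector_derivative_def has_derivative_at_withinI)
    show "((\<lambda>y. ?f x y) has_derivative blinfun_apply (?fy x y)) (at y within Y)"
      if "x \<in> A" "y \<in> Y" for x y
      using dy[OF inU[OF that]] by (simp add: has_vector_derivative_def has_derivative_at_withinI)
    have "continuous_on (A \<times> Y) (\<lambda>p. slice_dy I F (emb I (Complex (fst p) (snd p))))"
      using inU W by (intro continuous_on_compose2[OF cont continuous_on_subset[OF c2]]) auto
    then have "continuous_on (A \<times> Y) (\<lambda>p. ?fy (fst p) (snd p))"
      by (rule bounded_linear.continuous_on[OF bounded_linear_blinfun_scaleR_left])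
    then show "continuous (at (Re z, Im z) within A \<times> Y) (\<lambda>(x, y). ?fy x y)"
      using AB(3) e by (auto simp: continuous_on_eq_continuous_within Y_def split_def)
    show "Im z \<in> Y" "convex Y" using e by (auto simp: Y_def)
  qed
  then have "((\<lambda>(x, y). ?f x y) has_derivative
    (\<lambda>(tx, ty). tx *\<^sub>R slice_dx F (emb I z) + ty *\<^sub>R slice_dy I F (emb I z))) (at (Re z, Im z))"
    using at_within_open[of "(Re z, Im z)" "A \<times> Y"] AB e by (simp add: Y_def open_Times)
  then have "((\<lambda>(x, y). ?f x y) \<circ> (\<lambda>w. (Re w, Im w)) has_derivative
    (\<lambda>(tx, ty). tx *\<^sub>R slice_dx F (emb I z) + ty *\<^sub>R slice_dy I F (emb I z)) \<circ> (\<lambda>h. (Re h, Im h))) (at z)"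
    by (intro diff_chain_at) (auto intro!: derivative_eq_intros)
  moreover have "slice_dy I F (emb I z) = slice_dx F (emb I z) * I"
    using dy_eq W assms(4) by blast
  ultimately show ?thesis
    by (simp add: o_def emb_def algebra_simps)
qed

text \<open>The chain rule along the lines \<open>z + t * c\<close> with \<open>c = 1\<close> and
  \<open>c = \<i>\<close>. It identifies an unnamed factor \<open>d\<close> with
  \<open>slice_dx\<close>.\<close>

lemma slice_derivatives_eq:
  assumes "((\<lambda>w. F (emb I w)) has_derivative (\<lambda>h. d * emb I h)) (at z)"
  shows "((\<lambda>t. F (emb I z + of_real t)) has_vector_derivative d) (at 0)" (is "(?f has_vector_derivative _) _")
    and "((\<lambda>t. F (emb I z + of_real t * I)) has_vector_derivative d * I) (at 0)" (is "(?g has_vector_derivative _) _")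
    and "slice_dx F (emb I z) = d" "slice_dy I F (emb I z) = d * I"
proof -
  have *: "((\<lambda>t::real. F (emb I (z + of_real t * c))) has_vector_derivative d * emb I c) (at 0)" for c
  proof -
    have "((\<lambda>t::real. z + of_real t * c) has_derivative (\<lambda>t. of_real t * c)) (at 0)"
      by (auto intro!: derivative_eq_intros)
    moreover have "((\<lambda>w. F (emb I w)) has_derivative (\<lambda>h. d * emb I h)) (at (z + of_real 0 * c))"
      using assms by simp
    ultimately have "((\<lambda>w. F (emb I w)) \<circ> (\<lambda>t::real. z + of_real t * c) has_derivative
        (\<lambda>h. d * emb I h) \<circ> (\<lambda>t. of_real t * c)) (at 0)"
      by (rule diff_chain_at)
    then show ?thesis
      by (simp add: has_vector_derivative_def o_def emb_def algebra_simps)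
  qed
  have "(\<lambda>t::real. F (emb I (z + of_real t * 1))) = ?f" "(\<lambda>t::real. F (emb I (z + of_real t * \<i>))) = ?g"
    by (auto simp: fun_eq_iff emb_def of_real_def algebra_simps)
  with *[of 1] *[of \<i>] show f: "(?f has_vector_derivative d) (at 0)"
    and g: "(?g has_vector_derivative d * I) (at 0)"
    by (simp_all add: emb_def)
  show "slice_dx F (emb I z) = d" "slice_dy I F (emb I z) = d * I"
    unfolding slice_dx_def slice_dy_def using f g by (auto intro: vector_derivative_at)
qed

text \<open>The quaternion norm is multiplicative and \<open>emb I\<close> is isometric, so the
  relative error of the linear approximation has the same norm as the quotient minus
  \<open>d\<close>.\<close>

lemma slice_has_derivative_iff:
  assumes I: "I \<in> imag_units"
  shows "(f has_derivative (\<lambda>h. d * emb I h)) (at z) \<longleftrightarrow>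
    ((\<lambda>w. (f w - f z) * inverse (emb I (w - z))) \<longlongrightarrow> d) (at z)"
proof -
  have eq: "norm (f w - f z - d * emb I (w - z)) / norm (w - z)
      = norm ((f w - f z) * inverse (emb I (w - z)) - d)" if "w \<noteq> z" for w
  proof -
    have nz: "emb I (w - z) \<noteq> 0" using that emb_eq_0_iff[OF I, of "w - z"] by simp
    have "(f w - f z) * inverse (emb I (w - z)) - d
        = (f w - f z - d * emb I (w - z)) * inverse (emb I (w - z))"
      by (simp only: left_diff_distrib mult.assoc right_inverse[OF nz] mult_1_right)
    then show ?thesis
      by (simp only: norm_mult norm_inverse norm_emb[OF I] divide_inverse)
  qed
  have "bounded_linear (\<lambda>h. d * emb I h)"
    by (rule bounded_linear_compose[OF bounded_linear_mult_right bounded_linear_emb])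
  then have "(f has_derivative (\<lambda>h. d * emb I h)) (at z) \<longleftrightarrow>
      ((\<lambda>w. norm (f w - f z - d * emb I (w - z)) / norm (w - z)) \<longlongrightarrow> 0) (at z)"
    unfolding has_derivative_iff_norm by blast
  also have "\<dots> \<longleftrightarrow> ((\<lambda>w. norm ((f w - f z) * inverse (emb I (w - z)) - d)) \<longlongrightarrow> 0) (at z)"
    by (rule tendsto_cong) (unfold eventually_at_filter, intro always_eventually allI impI eq)
  also have "\<dots> \<longleftrightarrow> ((\<lambda>w. (f w - f z) * inverse (emb I (w - z))) \<longlongrightarrow> d) (at z)"
    unfolding tendsto_norm_zero_iff by (rule LIM_zero_iff)
  finally show ?thesis .
qed

text \<open>The map sending \<open>v\<close> to
  \<open>Complex (inner e v) (- inner e (v * I))\<close> takes \<open>v * I\<close> to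
  \<open>\<i>\<close> times the image of \<open>v\<close>. Composing with it yields ordinary
  holomorphic functions, whose real parts are the components of \<open>f\<close>.\<close>

lemma slice_holomorphic:
  assumes "I \<in> imag_units" "open S"
    and "\<And>z. z \<in> S \<Longrightarrow> (f has_derivative (\<lambda>h. d z * emb I h)) (at z)"
  defines "h \<equiv> \<lambda>e z. Complex (inner e (f z)) (- inner e (f z * I))"
  shows "h e holomorphic_on S"
    and "z \<in> S \<Longrightarrow> deriv (h e) z = Complex (inner e (d z)) (- inner e (d z * I))"
proof -
  have *: "(h e has_field_derivative Complex (inner e (d z)) (- inner e (d z * I))) (at z)"
    if z: "z \<in> S" for z
  proof -
    have "(h e has_derivative (\<lambda>k. Complex (inner e (d z * emb I k)) (- inner e (d z * emb I k * I)))) (at z)"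
      unfolding h_def Complex_eq using assms(3)[OF z] by (auto intro!: derivative_eq_intros)
    moreover have "Complex (inner e (d z * emb I k)) (- inner e (d z * emb I k * I))
        = Complex (inner e (d z)) (- inner e (d z * I)) * k" for k
      by (simp add: complex_eq_iff emb_def inner_add_right algebra_simps imag_unit_square[OF assms(1)])
    ultimately show ?thesis
      by (simp add: has_field_derivative_def)
  qed
  then show "h e holomorphic_on S"
    using assms(2) by (auto simp: holomorphic_on_open)
  show "z \<in> S \<Longrightarrow> deriv (h e) z = Complex (inner e (d z)) (- inner e (d z * I))"
    using * by (rule DERIV_imp_deriv)
qed

text \<open>Goursat's theorem, applied to each scalar function \<open>?h\<close>: its derivative is
  again holomorphic, hence continuous, and has \<open>inner e (d z)\<close> as real part.\<close>

lemma slice_derivative_continuous: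
  assumes "I \<in> imag_units" "open S"
    and "\<And>z. z \<in> S \<Longrightarrow> (f has_derivative (\<lambda>h. d z * emb I h)) (at z)"
  shows "continuous_on S d"
proof -
  have "continuous_on S (\<lambda>z. inner e (d z))" for e
  proof -
    let ?h = "\<lambda>z. Complex (inner e (f z)) (- inner e (f z * I))"
    have "continuous_on S (\<lambda>z. Re (deriv ?h z))"
      using slice_holomorphic(1)[OF assms] assms(2)
      by (intro continuous_intros holomorphic_on_imp_continuous_on holomorphic_deriv)
    then show ?thesis
      by (rule continuous_on_eq) (simp add: slice_holomorphic(2)[OF assms])
  qed
  then show ?thesis
    by (subst continuous_on_componentwise) (simp add: inner_commute)
qed

section \<open>The representation formula\<close>

text \<open>The difference \<open>E\<close> of the two sides is complex differentiable with
  \<open>J\<close> acting from the right, and it vanishes at real points. The identity theorem on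
  the connected set \<open>S\<close> gives \<open>E z = 0\<close>.\<close>

lemma representation_formula:
  assumes "slice_regular_on U F" "slice_domain U" "invariant U"
    and I: "I \<in> imag_units" and J: "J \<in> imag_units" and z: "emb J z \<in> U"
  shows "F (emb J z) = (1/2) *\<^sub>R (F (emb I z) + F (emb I (cnj z)))
    + (1/2) *\<^sub>R (F (emb I (cnj z)) - F (emb I z)) * I * J"
proof -
  have opn: "open U" using assms(2) by (simp add: slice_domain_def)
  define S where "S = {z. emb J z \<in> U}"
  have S_open: "open S" unfolding S_def using opn by (rule open_emb_vimage)
  have S_sym: "emb K w \<in> U" if "K \<in> imag_units" "w \<in> S" for K w
    using invariant_emb[OF assms(3) J that(1)] that(2) by (simp add: S_def)
  obtain r :: real where r: "of_real r \<in> S"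
    using assms(2) by (auto simp: slice_domain_def S_def elim!: Reals_cases)
  have S_conn: "connected S"
  proof -
    obtain \<epsilon> where \<epsilon>: "\<epsilon> > 0" "ball (of_real r) \<epsilon> \<subseteq> S"
      using S_open r openE by blast
    \<comment> \<open>Connectedness is assumed for planes through nonreal points of
      \<open>U\<close>, and \<open>J\<close> itself may lie outside \<open>U\<close>. A nonreal
      point near \<open>r\<close> spans the same plane as \<open>J\<close>.\<close>
    define w where "w = Complex r (\<epsilon>/2)"
    have "w \<in> S" using \<epsilon> by (auto simp: w_def dist_norm cmod_def intro!: subsetD[OF \<epsilon>(2)])
    moreover have "emb J w \<notin> \<real>"
    proof
      assume "emb J w \<in> \<real>"
      then obtain t where "emb J w = of_real t" by (rule Reals_cases)
      then have "emb J (w - of_real t) = 0" by simp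
      then have "w = of_real t" using emb_eq_0_iff[OF J] by (simp del: emb_simps)
      then show False using \<epsilon>(1) by (simp add: w_def complex_eq_iff)
    qed
    ultimately have "connected (U \<inter> slice_plane (emb J w))"
      using assms(2) by (simp add: slice_domain_def S_def)
    moreover have "slice_plane (emb J w) = range (emb J)"
    proof -
      have 1: "of_real x + of_real y * emb J w = emb J (of_real x + of_real y * w)" for x y
        by (simp add: emb_mult[OF J])
      \<comment> \<open>The coefficients are the coordinates of \<open>v\<close> in the real basis
        \<open>1, w\<close> of the complex plane.\<close>
      have 2: "emb J v = emb J (of_real (Re v - Im v * r / (\<epsilon>/2)) + of_real (Im v / (\<epsilon>/2)) * w)" for v
        using \<epsilon>(1) by (intro arg_cong[where f = "emb J"]) (simp add: w_def complex_eq_iff)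
      show ?thesis
      proof (intro equalityI subsetI)
        fix q assume "q \<in> slice_plane (emb J w)"
        then show "q \<in> range (emb J)" unfolding slice_plane_def using 1 by blast
      next
        fix q assume "q \<in> range (emb J)"
        then obtain v where "q = emb J v" ..
        then have "q = of_real (Re v - Im v * r / (\<epsilon>/2)) + of_real (Im v / (\<epsilon>/2)) * emb J w"
          using 2[of v] unfolding 1 by (rule trans)
        then show "q \<in> slice_plane (emb J w)" unfolding slice_plane_def by blast
      qed
    qed
    ultimately have "connected (U \<inter> range (emb J))" by simp
    moreover have "S = (\<lambda>q. Complex (inner q 1) (inner q J)) ` (U \<inter> range (emb J))"
    proof -
      show ?thesis
      proof (intro equalityI subsetI)
        fix v assume "v \<in> S"
        then show "v \<in> (\<lambda>q. Complex (inner q 1) (inner q J)) ` (U \<inter> range (emb J))"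
          by (intro image_eqI[of _ _ "emb J v"]) (simp_all add: S_def emb_left_inverse[OF J])
      qed (auto simp: S_def emb_left_inverse[OF J])
    qed
    moreover have "continuous_on (U \<inter> range (emb J)) (\<lambda>q. Complex (inner q 1) (inner q J))"
      unfolding Complex_eq by (intro continuous_intros)
    ultimately show ?thesis using connected_continuous_image by metis
  qed
  define a where "a = (\<lambda>z. slice_dx F (emb I z))"
  define b where "b = (\<lambda>z. slice_dx F (emb I (cnj z)))"
  define E where "E = (\<lambda>z. F (emb J z) - ((1/2) *\<^sub>R (F (emb I z) + F (emb I (cnj z)))
    + (1/2) *\<^sub>R (F (emb I (cnj z)) - F (emb I z)) * I * J))"
  define d where "d = (\<lambda>z. slice_dx F (emb J z) - ((1/2) *\<^sub>R (a z + b z) + (1/2) *\<^sub>R (b z - a z) * I * J))"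
  have E: "(E has_derivative (\<lambda>h. d w * emb J h)) (at w)" if w: "w \<in> S" for w
  proof -
    have 1: "((\<lambda>z. F (emb J z)) has_derivative (\<lambda>h. slice_dx F (emb J w) * emb J h)) (at w)"
      using slice_regular_has_derivative[OF assms(1) opn J] w by (simp add: S_def)
    have 2: "((\<lambda>z. F (emb I z)) has_derivative (\<lambda>h. a w * emb I h)) (at w)"
      using slice_regular_has_derivative[OF assms(1) opn I S_sym[OF I w]] by (simp add: a_def)
    have 3: "((\<lambda>z. F (emb I (cnj z))) has_derivative (\<lambda>h. b w * emb I (cnj h))) (at w)"
      using slice_regular_has_derivative[OF assms(1) opn imag_unit_minus[OF I]
          S_sym[OF imag_unit_minus[OF I] w]] by (simp add: b_def emb_cnj)
    have "(E has_derivative (\<lambda>h. slice_dx F (emb J w) * emb J h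
        - ((1/2) *\<^sub>R (a w * emb I h + b w * emb I (cnj h))
          + (1/2) *\<^sub>R (b w * emb I (cnj h) - a w * emb I h) * I * J))) (at w)"
      unfolding E_def by (intro derivative_intros 1 2 3)
    \<comment> \<open>The two halves carry the right factors \<open>1 - I * J\<close> and
      \<open>1 + I * J\<close>. Since \<open>I * (1 - I * J) = (1 - I * J) * J\<close> and
      \<open>- I * (1 + I * J) = (1 + I * J) * J\<close>, both \<open>I\<close> and
      \<open>- I\<close> turn into \<open>J\<close>.\<close>
    moreover have "slice_dx F (emb J w) * emb J h
        - ((1/2) *\<^sub>R (a w * emb I h + b w * emb I (cnj h))
          + (1/2) *\<^sub>R (b w * emb I (cnj h) - a w * emb I h) * I * J) = d w * emb J h" for h
      by (simp add: d_def emb_def algebra_simps imag_unit_square[OF I] imag_unit_square[OF J])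
    ultimately show ?thesis by simp
  qed
  have "inner e (E z) = 0" for e
  proof -
    let ?h = "\<lambda>z. Complex (inner e (E z)) (- inner e (E z * J))"
    have "?h z = 0"
    proof (rule analytic_continuation[of ?h S "S \<inter> \<real>" "of_real r"])
      show "?h holomorphic_on S"
        by (rule slice_holomorphic(1)[OF J S_open E])
      \<comment> \<open>At a real point conjugation is trivial and all embeddings agree.\<close>
      show "?h w = 0" if "w \<in> S \<inter> \<real>" for w
        using that by (auto simp: E_def complex_eq_iff elim!: Reals_cases simp flip: scaleR_2)
      show "of_real r islimpt S \<inter> \<real>"
      proof -
        have "(of_real r :: complex) islimpt \<real>"
        proof (rule islimptI)
          fix T :: "complex set" assume "of_real r \<in> T" "open T"
          then obtain \<epsilon> where \<epsilon>: "\<epsilon> > 0" "ball (of_real r) \<epsilon> \<subseteq> T"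
            using openE by blast
          then have "of_real (r + \<epsilon>/2) \<in> T"
            by (intro subsetD[OF \<epsilon>(2)]) (simp add: dist_norm)
          then show "\<exists>y\<in>\<real>. y \<in> T \<and> y \<noteq> of_real r"
            using \<epsilon>(1) by (intro bexI[of _ "of_real (r + \<epsilon>/2)"]) auto
        qed
        then show ?thesis
          using islimpt_Int_eventually[of "of_real r" \<real> S] eventually_at_topological S_open r
          by (metis (no_types, lifting) Int_commute)
      qed
    qed (use z r S_open S_conn in \<open>auto simp: S_def\<close>)
    then show ?thesis by (simp add: complex_eq_iff)
  qed
  then have "E z = 0" by (metis inner_eq_zero_iff)
  then show ?thesis by (simp add: E_def)
qed

section \<open>Extending functions from one slice to all slices\<close>

lemma scaleR_half_add: "(1/2) *\<^sub>R a + (1/2) *\<^sub>R a = (a :: quat)"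
  by (simp flip: scaleR_add_left)

text \<open>Moved to the left past \<open>1 - I * J\<close> or \<open>1 + I * J\<close>,
  \<open>emb J z\<close> becomes \<open>emb I z\<close> or \<open>emb I (cnj z)\<close>, while
  \<open>emb I z0\<close> commutes with \<open>I\<close>. So multiplication by the difference off
  the slice becomes multiplication of \<open>a\<close> and \<open>b\<close> by differences on the
  slice.\<close>

lemma half_sum_product:
  fixes a b :: quat
  assumes I: "I \<in> imag_units" and J: "J \<in> imag_units"
    and A: "A = (1/2) *\<^sub>R (a + b)" and B: "B = (1/2) *\<^sub>R (b - a) * I"
  shows "A * (emb J z - emb I z0) + B * (emb J z - emb I z0) * J
    = (1/2) *\<^sub>R (a * emb I (z - z0) + b * emb I (cnj z - z0))
    + (1/2) *\<^sub>R (b * emb I (cnj z - z0) - a * emb I (z - z0)) * I * J"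
  by (simp add: A B emb_def algebra_simps imag_unit_square[OF I] imag_unit_square[OF J])

definition im_part :: "quat \<Rightarrow> quat" where
  "im_part q = q - of_real (qr q)"

definition upper :: "quat \<Rightarrow> complex" where
  "upper q = Complex (qr q) (norm (im_part q))"

text \<open>A nonreal quaternion is \<open>emb J z\<close> for two pairs, \<open>(z, J)\<close> and
  \<open>(cnj z, - J)\<close>; the one with \<open>Im z > 0\<close> is chosen. At real points
  \<open>sgn\<close> is 0 and the \<open>B\<close> term drops out.\<close>

definition slice_extension :: "(complex \<Rightarrow> quat) \<Rightarrow> (complex \<Rightarrow> quat) \<Rightarrow> quat \<Rightarrow> quat" where
  "slice_extension A B q = A (upper q) + B (upper q) * sgn (im_part q)"

lemma im_part_emb: "J \<in> imag_units \<Longrightarrow> im_part (emb J z) = Im z *\<^sub>R J"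
  by (simp add: im_part_def emb_def imag_units_iff of_real_def)

lemma upper_emb: "J \<in> imag_units \<Longrightarrow> upper (emb J z) = Complex (Re z) \<bar>Im z\<bar>"
  by (simp add: upper_def im_part_emb norm_imag_unit) (simp add: emb_def imag_units_iff)

lemma quat_eq_minus: "q = - q \<Longrightarrow> q = (0 :: quat)"
  by (simp add: quat_eq_iff)

text \<open>With \<open>A\<close> even and \<open>B\<close> odd under conjugation, the pairs
  \<open>(z, J)\<close> and \<open>(cnj z, - J)\<close> give the same value. At real
  \<open>z\<close> oddness forces \<open>B z = 0\<close>, in agreement with
  \<open>sgn 0 = 0\<close>.\<close>

lemma slice_extension_emb:
  assumes "J \<in> imag_units" and A: "\<And>z. A (cnj z) = A z" and B: "\<And>z. B (cnj z) = - B z"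
  shows "slice_extension A B (emb J z) = A z + B z * J"
proof -
  consider "Im z > 0" | "Im z = 0" | "Im z < 0" by linarith
  then show ?thesis
  proof cases
    case 1
    then have "upper (emb J z) = z" "sgn (im_part (emb J z)) = J"
      using assms(1) by (auto simp: upper_emb im_part_emb complex_eq_iff sgn_scaleR
          sgn_div_norm norm_imag_unit)
    then show ?thesis by (simp add: slice_extension_def)
  next
    case 2
    then have z: "upper (emb J z) = z" "im_part (emb J z) = 0" "cnj z = z"
      using assms(1) by (auto simp: upper_emb im_part_emb complex_eq_iff)
    then have "B z = 0" using B[of z] by (intro quat_eq_minus) simp
    with z show ?thesis by (simp add: slice_extension_def)
  next
    case 3
    then have "upper (emb J z) = cnj z" "sgn (im_part (emb J z)) = - J"
      using assms(1) by (auto simp: upper_emb im_part_emb complex_eq_iff sgn_scaleR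
          sgn_div_norm norm_imag_unit)
    then show ?thesis by (simp add: slice_extension_def A B)
  qed
qed

lemma qr_eq_inner: "qr q = inner q 1"
  by (simp add: inner_quat_def)

lemma continuous_on_im_part: "continuous_on S im_part"
  unfolding im_part_def[abs_def] qr_eq_inner by (intro continuous_intros)

lemma continuous_on_upper: "continuous_on S upper"
  unfolding upper_def[abs_def] Complex_eq qr_eq_inner
  by (intro continuous_intros continuous_on_im_part)

text \<open>At a real point, oddness makes \<open>B\<close> vanish, which compensates the jump of
  \<open>sgn (im_part q)\<close>.\<close>
lemma continuous_slice_extension:
  assumes "continuous_on (upper ` U) A" "continuous_on (upper ` U) B"
    and B: "\<And>z. B (cnj z) = - B z" and p: "p \<in> U"
  shows "continuous (at p within U) (slice_extension A B)"
proof -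
  have A': "((\<lambda>q. A (upper q)) \<longlongrightarrow> A (upper p)) (at p within U)"
    and B': "((\<lambda>q. B (upper q)) \<longlongrightarrow> B (upper p)) (at p within U)"
    using continuous_on_compose2[OF assms(1) continuous_on_upper[of U] subset_refl]
      continuous_on_compose2[OF assms(2) continuous_on_upper[of U] subset_refl] p
    by (auto simp: continuous_on_def)
  have im: "(im_part \<longlongrightarrow> im_part p) (at p within U)"
    using continuous_on_im_part[of U] p by (auto simp: continuous_on_def)
  have "((\<lambda>q. B (upper q) * sgn (im_part q)) \<longlongrightarrow> B (upper p) * sgn (im_part p)) (at p within U)"
  proof (cases "im_part p = 0")
    case False
    with B' im show ?thesis by (intro tendsto_intros)
  next
    case True
    then have "B (upper p) = 0"
      using B[of "upper p"] by (intro quat_eq_minus) (simp add: upper_def complex_cnj)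
    with B' have "((\<lambda>q. norm (B (upper q))) \<longlongrightarrow> 0) (at p within U)"
      by (simp add: tendsto_norm_zero)
    then have "((\<lambda>q. B (upper q) * sgn (im_part q)) \<longlongrightarrow> 0) (at p within U)"
      by (rule Lim_null_comparison[rotated])
        (auto simp: norm_mult norm_sgn intro!: always_eventually)
    with True show ?thesis by simp
  qed
  with A' show ?thesis
    unfolding continuous_within slice_extension_def[abs_def] by (intro tendsto_add)
qed

section \<open>From slice regularity to skew regularity\<close>

lemma slice_regular_imp_skew_regular:
  assumes F: "slice_regular_on U F" and U: "slice_domain U" "invariant U"
  shows "skew_regular_on U F"
  unfolding skew_regular_on_def
proof
  fix q0 assume q0: "q0 \<in> U"
  obtain I z0 where I: "I \<in> imag_units" and z0: "q0 = emb I z0"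
    by (rule quat_emb_ex)
  have opn: "open U" using U(1) by (simp add: slice_domain_def)
  define S where "S = {z. emb I z \<in> U}"
  have S_open: "open S" unfolding S_def using opn by (rule open_emb_vimage)
  have S_cnj: "cnj z \<in> S" if "z \<in> S" for z
    using invariant_emb_cnj[OF U(2) I] that by (simp add: S_def)
  have in_S: "z \<in> S" if "J \<in> imag_units" "emb J z \<in> U" for J z
    using invariant_emb[OF U(2) that(1) I that(2)] by (simp add: S_def)
  have deriv: "((\<lambda>w. F (emb I w)) has_derivative (\<lambda>h. slice_dx F (emb I z) * emb I h)) (at z)"
    if "z \<in> S" for z
    using slice_regular_has_derivative[OF F opn I] that by (simp add: S_def)

  \<comment> \<open>The difference quotient on the slice, filled in at \<open>z0\<close> with the
    derivative so that it becomes continuous there.\<close>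
  define D0 where "D0 = (\<lambda>z. if z = z0 then slice_dx F q0
    else (F (emb I z) - F q0) * inverse (emb I (z - z0)))"
  have D0: "D0 z * emb I (z - z0) = F (emb I z) - F q0" for z
    by (cases "z = z0") (auto simp: D0_def z0 mult.assoc emb_eq_0_iff[OF I] simp del: emb_simps(5))
  have D0_cont: "continuous_on S D0"
    unfolding continuous_on_eq_continuous_at[OF S_open]
  proof
    fix z assume z: "z \<in> S"
    have Fz: "((\<lambda>w. F (emb I w)) \<longlongrightarrow> F (emb I z)) (at z)"
      using has_derivative_continuous[OF deriv[OF z]] by (simp add: continuous_at)
    have embz: "((\<lambda>w. emb I (w - z0)) \<longlongrightarrow> emb I (z - z0)) (at z)"
      by (intro bounded_linear.tendsto[OF bounded_linear_emb] tendsto_intros)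
    have ev: "eventually (\<lambda>w. (F (emb I w) - F q0) * inverse (emb I (w - z0)) = D0 w) (at z)"
    proof (cases "z = z0")
      case True
      then show ?thesis by (auto simp: eventually_at_filter D0_def)
    next
      case False
      have "eventually (\<lambda>w. w \<noteq> z0) (at z)"
        using False by (intro tendsto_imp_eventually_ne[OF tendsto_ident_at])
      then show ?thesis by eventually_elim (simp add: D0_def)
    qed
    have "((\<lambda>w. (F (emb I w) - F q0) * inverse (emb I (w - z0))) \<longlongrightarrow> D0 z) (at z)"
    proof (cases "z = z0")
      case False
      then show ?thesis unfolding D0_def using emb_eq_0_iff[OF I, of "z - z0"]
        by (simp del: emb_simps) (intro tendsto_intros Fz embz; simp del: emb_simps)
    next
      case True
      then have "((\<lambda>w. (F (emb I w) - F q0) * inverse (emb I (w - z0))) \<longlongrightarrow> slice_dx F q0) (at z0)"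
        using deriv[OF z] unfolding slice_has_derivative_iff[OF I] z0 by simp
      then show ?thesis by (simp add: True D0_def del: emb_simps)
    qed
    then show "isCont D0 z"
      unfolding continuous_at using ev by (rule Lim_transform_eventually)
  qed

  \<comment> \<open>The coefficients of the representation formula with \<open>D0\<close> in place
    of \<open>F\<close>; thus \<open>A z + B z * I = D0 z\<close>.\<close>
  define A where "A = (\<lambda>z. (1/2) *\<^sub>R (D0 z + D0 (cnj z)))"
  define B where "B = (\<lambda>z. (1/2) *\<^sub>R (D0 (cnj z) - D0 z) * I)"
  have A_cnj: "A (cnj z) = A z" and B_cnj: "B (cnj z) = - B z" for z
    by (simp_all add: A_def B_def algebra_simps)
  have "continuous_on S (\<lambda>z. D0 (cnj z))"
    by (rule continuous_on_compose2[OF D0_cont]) (auto intro!: continuous_intros S_cnj)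
  then have "continuous_on S A" "continuous_on S B"
    unfolding A_def B_def by (auto intro!: continuous_intros D0_cont)
  moreover have "upper ` U \<subseteq> S"
  proof
    fix w assume "w \<in> upper ` U"
    then obtain q where "q \<in> U" "w = upper q" by blast
    moreover obtain J z where J: "J \<in> imag_units" "q = emb J z" by (rule quat_emb_ex)
    ultimately have "z \<in> S" "w = z \<or> w = cnj z"
      using in_S by (auto simp: upper_emb complex_eq_iff abs_if)
    then show "w \<in> S" using S_cnj by auto
  qed
  ultimately have cont: "continuous (at p within U) (slice_extension A B)" if "p \<in> U" for p
    by (intro continuous_slice_extension B_cnj that) (blast intro: continuous_on_subset)+

  have "F x = F q0 + (slice_extension A B \<diamondop> (\<lambda>t. t - q0)) x" if x: "x \<in> U" for x
  proof (cases "x = q0")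
    case True
    then show ?thesis by (simp add: skew_prod_def)
  next
    case False
    obtain J z where J: "J \<in> imag_units" and z: "x = emb J z" by (rule quat_emb_ex)
    define g where "g = x - q0"
    have g: "g \<noteq> 0" using False by (simp add: g_def)
    \<comment> \<open>Conjugation changes the unit \<open>J\<close> but not the coordinate
      \<open>z\<close>.\<close>
    have "slice_extension A B (conj_act g x) = A z + B z * conj_act g J"
      unfolding z conj_act_emb[OF g]
      by (intro slice_extension_emb conj_act_imag_unit g J A_cnj B_cnj)
    \<comment> \<open>The factor \<open>g\<close> cancels the inverse inside
      \<open>conj_act g J\<close>, which leaves \<open>J\<close> on the far right.\<close>
    then have "(slice_extension A B \<diamondop> (\<lambda>t. t - q0)) x = A z * g + B z * g * J"
      using g by (simp add: skew_prod_def conj_act_def g_def[symmetric] distrib_right mult.assoc)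
    also have "\<dots> = (1/2) *\<^sub>R (D0 z * emb I (z - z0) + D0 (cnj z) * emb I (cnj z - z0))
      + (1/2) *\<^sub>R (D0 (cnj z) * emb I (cnj z - z0) - D0 z * emb I (z - z0)) * I * J"
      unfolding g_def z z0
      by (rule half_sum_product[OF I J]) (simp_all add: A_def B_def)
    \<comment> \<open>By \<open>D0\<close> both products contain \<open>- F q0\<close>: it survives
      in the half sum and cancels in the half difference.\<close>
    also have "\<dots> = (1/2) *\<^sub>R (F (emb I z) + F (emb I (cnj z)))
      + (1/2) *\<^sub>R (F (emb I (cnj z)) - F (emb I z)) * I * J - F q0"
      unfolding D0 by (simp add: algebra_simps) (simp add: scaleR_half_add flip: scaleR_2)
    also have "\<dots> = F x - F q0"
      using representation_formula[OF F U I J, of z] x by (simp add: z)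
    finally show ?thesis by simp
  qed
  with cont orbit_subset[OF U(2) q0] show "skew_differentiable_at U F q0"
    unfolding skew_differentiable_at_def by blast
qed

section \<open>From skew regularity to slice regularity\<close>

text \<open>On a slice everything commutes, so the action drops out of the skew product.\<close>
lemma skew_differentiable_slice:
  assumes D: "\<And>x. x \<in> U \<Longrightarrow> F x = F q + (D \<diamondop> (\<lambda>t. t - q)) x"
    and cont: "continuous (at q within U) D" and "open U" "q \<in> U"
    and I: "I \<in> imag_units" and q: "q = emb I z"
  shows "((\<lambda>w. F (emb I w)) has_derivative (\<lambda>h. D q * emb I h)) (at z)"
  unfolding slice_has_derivative_iff[OF I]
proof (rule Lim_transform_eventually)
  have "isCont D (emb I z)"
    using cont at_within_open[OF assms(4,3)] by (simp add: q)
  moreover have "isCont (emb I) z"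
    using continuous_on_emb[of UNIV I] by (simp add: continuous_on_eq_continuous_at)
  ultimately have "isCont (\<lambda>w. D (emb I w)) z" by (rule isCont_o2[rotated])
  then show "((\<lambda>w. D (emb I w)) \<longlongrightarrow> D q) (at z)" by (simp add: continuous_at q)
  have "D (emb I w) = (F (emb I w) - F (emb I z)) * inverse (emb I (w - z))"
    if w: "w \<in> {w. emb I w \<in> U}" "w \<noteq> z" for w
  proof -
    let ?g = "emb I (w - z)"
    have g: "?g \<noteq> 0" using emb_eq_0_iff[OF I, of "w - z"] w by simp
    have "conj_act ?g (emb I w) = emb I ((w - z) * w) * inverse ?g"
      by (simp only: conj_act_def emb_mult[OF I])
    also have "\<dots> = emb I (w * (w - z)) * inverse ?g"
      by (simp only: mult.commute)
    also have "\<dots> = emb I w"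
      by (simp only: emb_mult[OF I] mult.assoc right_inverse[OF g] mult_1_right)
    finally have "conj_act ?g (emb I w) = emb I w" .
    moreover have "F (emb I w) = F q + D (conj_act ?g (emb I w)) * ?g"
      using D[of "emb I w"] w(1) g by (simp add: skew_prod_def q)
    ultimately have "F (emb I w) - F (emb I z) = D (emb I w) * ?g"
      by (simp add: q)
    then show ?thesis
      by (simp only: mult.assoc right_inverse[OF g] mult_1_right)
  qed
  then show "eventually (\<lambda>w. D (emb I w) = (F (emb I w) - F (emb I z)) * inverse (emb I (w - z))) (at z)"
    using open_emb_vimage[OF assms(3), of I] assms(4) unfolding eventually_at_topological q by blast
qed

lemma skew_regular_has_derivative:
  assumes "skew_regular_on U F" "open U" "I \<in> imag_units" "emb I z \<in> U"
  shows "((\<lambda>w. F (emb I w)) has_derivative (\<lambda>h. slice_dx F (emb I z) * emb I h)) (at z)"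
proof -
  obtain D where cont: "\<forall>p\<in>orbit (emb I z). continuous (at p within U) D"
    and D: "\<And>x. x \<in> U \<Longrightarrow> F x = F (emb I z) + (D \<diamondop> (\<lambda>t. t - emb I z)) x"
    using assms(1,4) unfolding skew_regular_on_def skew_differentiable_at_def by blast
  have "((\<lambda>w. F (emb I w)) has_derivative (\<lambda>h. D (emb I z) * emb I h)) (at z)"
    using cont orbit_self
    by (intro skew_differentiable_slice[OF D _ assms(2,4,3) refl]) blast+
  then show ?thesis using slice_derivatives_eq(3) by metis
qed

text \<open>Skew differentiability gives a complex derivative at each point of a slice. The
  continuity of the partial derivatives comes from \<open>slice_derivative_continuous\<close>, and
  the Cauchy-Riemann equation from \<open>slice_dy I F q = slice_dx F q * I\<close>.\<close>

lemma skew_regular_imp_slice_regular: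
  assumes F: "skew_regular_on U F" and opn: "open U"
  shows "slice_regular_on U F"
  unfolding slice_regular_on_def
proof (intro ballI conjI)
  fix I assume I: "I \<in> imag_units"
  let ?P = "U \<inter> slice_plane I"
  define S where "S = {z. emb I z \<in> U}"
  have deriv: "((\<lambda>w. F (emb I w)) has_derivative (\<lambda>h. slice_dx F (emb I z) * emb I h)) (at z)"
    if "z \<in> S" for z
    using skew_regular_has_derivative[OF F opn I] that by (simp add: S_def)
  have dy: "slice_dy I F q = slice_dx F q * I" if "q \<in> ?P" for q
    using slice_derivatives_eq(4)[OF deriv] that by (auto simp: slice_plane_eq S_def)
  have "continuous_on S (\<lambda>z. slice_dx F (emb I z))"
    using open_emb_vimage[OF opn] deriv by (intro slice_derivative_continuous[OF I]) (auto simp: S_def)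
  then have "continuous_on ?P (\<lambda>q. slice_dx F (emb I (Complex (inner q 1) (inner q I))))"
  proof (rule continuous_on_compose2)
    show "continuous_on ?P (\<lambda>q. Complex (inner q 1) (inner q I))"
      unfolding Complex_eq by (intro continuous_intros)
  qed (auto simp: slice_plane_eq S_def emb_left_inverse[OF I])
  then show dx_cont: "continuous_on ?P (slice_dx F)"
    by (rule continuous_on_eq) (auto simp: slice_plane_eq emb_left_inverse[OF I])
  have "continuous_on ?P (\<lambda>q. slice_dx F q * I)"
    by (intro continuous_intros dx_cont)
  then show "continuous_on ?P (slice_dy I F)"
    by (rule continuous_on_eq) (simp add: dy)
  fix q assume q: "q \<in> ?P"
  then obtain z where z: "q = emb I z" "z \<in> S" by (auto simp: slice_plane_eq S_def)
  show "(\<lambda>t. F (q + of_real t)) differentiable at 0"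
    "(\<lambda>t. F (q + of_real t * I)) differentiable at 0"
    using slice_derivatives_eq(1,2)[OF deriv[OF z(2)]] unfolding z(1)
    by (auto intro: differentiableI_vector)
  show "(1/2) *\<^sub>R (slice_dx F q + slice_dy I F q * I) = 0"
    by (simp add: dy[OF q] mult.assoc imag_unit_square[OF I])
qed

section \<open>The skew inverse of \<open>T - q\<close> and the skew derivative\<close>

text \<open>\<open>G x = (x - cnj q) N(x)\<^sup>-\<^sup>1\<close>, where \<open>N(x) = x\<^sup>2 - 2 Re(q) x + |q|\<^sup>2\<close> has the zero set \<open>O(q)\<close>.\<close>
lemma skew_inverse_ex:
  "\<exists>G. is_skew_inverse_on (- orbit q) (\<lambda>t. t - q) G"
proof -
  obtain I z where I: "I \<in> imag_units" and q: "q = emb I z" by (rule quat_emb_ex)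
  define c where "c = emb I (cnj z)"
  define N where "N = (\<lambda>x. x * x - (Re z + Re z) *\<^sub>R x + ((Re z)\<^sup>2 + (Im z)\<^sup>2) *\<^sub>R (1::quat))"
  define G where "G = (\<lambda>x. (x - c) * inverse (N x))"
  \<comment> \<open>Both identities rest on \<open>q + c\<close> and \<open>q * c\<close> being
    real, equal to the trace and squared norm of \<open>q\<close>.\<close>
  have N1: "(x - c) * x - q * (x - c) = N x" and N2: "(x - q) * x - c * (x - q) = N x" for x
    by (simp_all add: N_def q c_def emb_def algebra_simps imag_unit_square[OF I] power2_eq_square)
      (simp_all add: quat_eq_iff)
  have c: "c \<in> orbit q"
    unfolding c_def q emb_cnj using orbit_emb[OF I imag_unit_minus[OF I]] .
  have "((\<lambda>t. t - q) \<diamondop> G) x = 1 \<and> (G \<diamondop> (\<lambda>t. t - q)) x = 1" if x: "x \<notin> orbit q" for x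
  proof
    define g where "g = x - q"
    have xc: "x - c \<noteq> 0" using x c by auto
    have g: "g \<noteq> 0" using x orbit_self[of q] by (auto simp: g_def)
    \<comment> \<open>A zero of \<open>N\<close> would be the conjugate of \<open>q\<close> by
      \<open>inverse (x - c)\<close>, hence a point of the orbit.\<close>
    have N: "N x \<noteq> 0"
    proof
      assume "N x = 0"
      then have "(x - c) * x = q * (x - c)" using N1[of x] by simp
      then have "inverse (x - c) * ((x - c) * x) = inverse (x - c) * (q * (x - c))" by simp
      then have "x = conj_act (inverse (x - c)) q"
        using xc by (simp add: conj_act_def mult.assoc[symmetric])
      then show False using x xc unfolding orbit_def by (auto simp: nonzero_imp_inverse_nonzero)
    qed
    have comm: "inverse (N x) * x = x * inverse (N x)"
    proof -
      have "N x * x = x * N x" by (simp add: N_def algebra_simps)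
      then have eq: "N x * x * inverse (N x) = x" using N by (simp add: mult.assoc)
      have "inverse (N x) * x = inverse (N x) * (N x * x * inverse (N x))"
        by (simp only: eq)
      also have "\<dots> = inverse (N x) * N x * x * inverse (N x)" by (simp only: mult.assoc)
      finally show ?thesis using N by simp
    qed
    have Gx: "G x \<noteq> 0" using xc N by (simp add: G_def)
    have "((\<lambda>t. t - q) \<diamondop> G) x = G x * x - q * G x"
      using Gx by (simp add: skew_prod_def conj_act_def left_diff_distrib mult.assoc)
    also have "\<dots> = ((x - c) * x - q * (x - c)) * inverse (N x)"
      by (simp only: G_def left_diff_distrib mult.assoc comm)
    also have "\<dots> = 1" unfolding N1 using N by simp
    finally show "((\<lambda>t. t - q) \<diamondop> G) x = 1" .
    \<comment> \<open>The polynomial \<open>N\<close> has real coefficients, so it is compatible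
      with conjugation.\<close>
    have "N (conj_act g x) = g * N x * inverse g"
    proof -
      have "conj_act g x * conj_act g x = g * x * (inverse g * g) * x * inverse g"
        unfolding conj_act_def by (simp only: mult.assoc)
      also have "\<dots> = g * (x * x) * inverse g" using g by (simp add: mult.assoc)
      finally show ?thesis
        using g by (simp add: N_def conj_act_def algebra_simps)
    qed
    then have "inverse (N (conj_act g x)) * g = g * inverse (N x)"
      using g N by (simp add: nonzero_inverse_mult_distrib mult.assoc)
    then have "(G \<diamondop> (\<lambda>t. t - q)) x = (conj_act g x - c) * g * inverse (N x)"
      using g by (simp add: skew_prod_def G_def mult.assoc g_def[symmetric])
    also have "(conj_act g x - c) * g = (x - q) * x - c * (x - q)"
      using g by (simp add: conj_act_def left_diff_distrib mult.assoc)
        (simp add: g_def left_diff_distrib right_diff_distrib)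
    also have "\<dots> * inverse (N x) = 1" unfolding N2 using N by simp
    finally show "(G \<diamondop> (\<lambda>t. t - q)) x = 1" .
  qed
  then show ?thesis unfolding is_skew_inverse_on_def by auto
qed

text \<open>For \<open>w = conj_act (G x) x\<close> the inverse relation says
  \<open>w - q = inverse (G x)\<close>, so conjugating \<open>w\<close> by \<open>w - q\<close>
  leads back to \<open>x\<close>. The defining equation of \<open>D\<close> at \<open>w\<close>
  therefore involves \<open>D x\<close>. This holds for whichever inverse \<open>SOME\<close>
  returns.\<close>

lemma skew_quotient:
  assumes D: "\<And>x. x \<in> U \<Longrightarrow> F x = F q + (D \<diamondop> (\<lambda>t. t - q)) x"
    and U: "invariant U" and x: "x \<in> U" "x \<notin> orbit q"
  shows "((\<lambda>t. F t - F q) \<diamondop> skew_inverse_on (- orbit q) (\<lambda>t. t - q)) x = D x"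
proof -
  define G where "G = skew_inverse_on (- orbit q) (\<lambda>t. t - q)"
  have "is_skew_inverse_on (- orbit q) (\<lambda>t. t - q) G"
    unfolding G_def skew_inverse_on_def by (rule someI_ex[OF skew_inverse_ex])
  then have "((\<lambda>t. t - q) \<diamondop> G) x = 1"
    using x(2) by (simp add: is_skew_inverse_on_def)
  then have Gx: "G x \<noteq> 0" and inv: "(conj_act (G x) x - q) * G x = 1"
    by (auto simp: skew_prod_def split: if_splits)
  define w where "w = conj_act (G x) x"
  have wU: "w \<in> U" using U x(1) Gx by (simp add: w_def invariant_def)
  have wq: "w - q = inverse (G x)" using inv by (metis w_def inverse_unique inverse_inverse_eq)
  have "conj_act (w - q) w = inverse (G x) * (G x * x * inverse (G x)) * G x"
    unfolding wq by (simp add: conj_act_def w_def)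
  also have "\<dots> = inverse (G x) * G x * x * (inverse (G x) * G x)"
    by (simp only: mult.assoc)
  also have "\<dots> = x" using Gx by simp
  finally have "(D \<diamondop> (\<lambda>t. t - q)) w = D x * (w - q)"
    using Gx wq by (simp add: skew_prod_def)
  then have "F w - F q = D x * (w - q)"
    by (subst D[OF wU]) simp
  then have "(F w - F q) * G x = D x"
    using inv by (simp add: w_def mult.assoc)
  then show ?thesis
    using Gx by (simp add: skew_prod_def w_def G_def)
qed

theorem theorem3p20:
  fixes U :: "quat set" and F :: "quat \<Rightarrow> quat"
  assumes "slice_domain U" and "invariant U"
  shows "(slice_regular_on U F \<longleftrightarrow> skew_regular_on U F) \<and>
    (slice_regular_on U F \<longrightarrow>
      (\<forall>I\<in>imag_units. \<forall>q \<in> U \<inter> slice_plane I.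
        has_skew_derivative U F q (slice_derivative I F q)))"
proof (intro conjI impI ballI)
  have opn: "open U" using assms(1) by (simp add: slice_domain_def)
  show iff: "slice_regular_on U F \<longleftrightarrow> skew_regular_on U F"
    using slice_regular_imp_skew_regular assms skew_regular_imp_slice_regular opn by blast
  fix I q assume F: "slice_regular_on U F" and I: "I \<in> imag_units" and q: "q \<in> U \<inter> slice_plane I"
  then obtain z where z: "q = emb I z" by (auto simp: slice_plane_eq)
  obtain D where cont: "\<forall>p\<in>orbit q. continuous (at p within U) D"
    and D: "\<And>x. x \<in> U \<Longrightarrow> F x = F q + (D \<diamondop> (\<lambda>t. t - q)) x"
    using F iff q unfolding skew_regular_on_def skew_differentiable_at_def by blast
  have contq: "continuous (at q within U) D" using cont orbit_self by blast
  have "((\<lambda>w. F (emb I w)) has_derivative (\<lambda>h. D q * emb I h)) (at z)"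
    using q by (intro skew_differentiable_slice[OF D contq opn _ I z]) auto
  \<comment> \<open>The partial derivatives are \<open>D q\<close> and \<open>D q * I\<close>; as
    \<open>I * I = -1\<close>, the two halves of the slice derivative coincide and add up to
    \<open>D q\<close>.\<close>
  from slice_derivatives_eq(3,4)[OF this] have "slice_derivative I F q = D q"
    by (simp add: slice_derivative_def z mult.assoc imag_unit_square[OF I] scaleR_half_add
        scaleR_add_right)
  moreover have "(D \<longlongrightarrow> D q) (at q within (U - orbit q))"
    using contq unfolding continuous_within by (rule tendsto_within_subset) blast
  \<comment> \<open>Off the orbit the skew quotient equals \<open>D\<close>, so the two have the
    same limit.\<close>
  then have "(((\<lambda>t. F t - F q) \<diamondop> skew_inverse_on (- orbit q) (\<lambda>t. t - q)) \<longlongrightarrow> D q)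
      (at q within (U - orbit q))"
    by (rule Lim_transform_eventually)
      (auto simp: eventually_at_filter skew_quotient[OF D assms(2)])
  ultimately show "has_skew_derivative U F q (slice_derivative I F q)"
    by (simp add: has_skew_derivative_def)
qed

end
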